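(* Let $\mathcal{F}$ be a run-closed family of s-partitions with size generating function $f(x)=\sum_{\pi\in\mathcal{F}}x^{|\pi|}$. Then the run transform $F(x,y)=\Phi(f(x))$ satisfies \[ F(x,y)=\sum_{\pi\in\mathcal{F}}x^{|\pi|}y^{\mathrm{run}(\pi)}, \] where $\mathrm{run}(\pi)$ is the number of runs of $\pi$.
   Context: The run transform is $\Phi\big(f(x)\big)=\frac{1-x}{1-xy}\,f\!\left(\frac{x(1-x)}{1-xy}\right)$. A set-of-lists partition (s-partition) of a finite set $S\subset\mathbb{Z}_{>0}$ is a partition of $S$ into a set of nonempty lists (linearly ordered blocks); its size $|\pi|$ is $|S|$. It is standard if $S=\{1,\dots,n\}$ for some $n\ge0$ (the empty s-partition $\epsilon$ included). A run is a block consisting of consecutive integers in increasing order, $i+1,i+2,\dots,i+\ell$. Deleting a run from a standard s-partition means removing that block and standardizing the remainder (replacing its smallest entry by 1, the next by 2, etc., keeping the block structure and orders). Inserting the run $i+1,\dots,i+\ell$ ($\ell\ge1$, $0\le i\le|\pi|$) into a standard s-partition $\pi$ means increasing by $\ell$ every entry of $\pi$ exceeding $i$ and adjoining $i+1,\dots,i+\ell$ as a new block. A run-closed family is a set of standard s-partitions closed under insertion and deletion of runs. *)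

theory Defs
  imports
    "HOL-Library.Disjoint_Sets"
    "HOL-Computational_Algebra.Formal_Power_Series"
begin

section \<open>Set-of-lists partitions\<close>

text \<open>Disjointness of distinct blocks also rules out two different orderings of the same
  underlying set.\<close>

definition s_partition :: "nat set \<Rightarrow> nat list set \<Rightarrow> bool" where
  "s_partition S \<pi> \<longleftrightarrow> finite S \<and> 0 \<notin> S \<and>
     (\<forall>b\<in>\<pi>. b \<noteq> [] \<and> distinct b) \<and> disjoint_family_on set \<pi> \<and> (\<Union>b\<in>\<pi>. set b) = S"

definition ground :: "nat list set \<Rightarrow> nat set" where
  "ground \<pi> = (\<Union>b\<in>\<pi>. set b)"

definition psize :: "nat list set \<Rightarrow> nat" where
  "psize \<pi> = card (ground \<pi>)"

definition standard :: "nat list set \<Rightarrow> bool" where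
  "standard \<pi> \<longleftrightarrow> (\<exists>n. s_partition {1..n} \<pi>)"

definition run_block :: "nat \<Rightarrow> nat \<Rightarrow> nat list" where
  "run_block i l = [i + 1..<i + l + 1]"

definition is_run :: "nat list \<Rightarrow> bool" where
  "is_run b \<longleftrightarrow> (\<exists>i l. l \<ge> 1 \<and> b = run_block i l)"

definition num_runs :: "nat list set \<Rightarrow> nat" where
  "num_runs \<pi> = card {b \<in> \<pi>. is_run b}"

definition standardize :: "nat list set \<Rightarrow> nat list set" where
  "standardize \<pi> = map (\<lambda>j. card {k \<in> ground \<pi>. k \<le> j}) ` \<pi>"

definition delete_run :: "nat list \<Rightarrow> nat list set \<Rightarrow> nat list set" where
  "delete_run b \<pi> = standardize (\<pi> - {b})"

definition insert_run :: "nat \<Rightarrow> nat \<Rightarrow> nat list set \<Rightarrow> nat list set" where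
  "insert_run i l \<pi> = insert (run_block i l) (map (\<lambda>j. if j > i then j + l else j) ` \<pi>)"

definition run_closed :: "nat list set set \<Rightarrow> bool" where
  "run_closed \<F> \<longleftrightarrow>
     (\<forall>\<pi>\<in>\<F>. standard \<pi>) \<and>
     (\<forall>\<pi>\<in>\<F>. \<forall>l\<ge>1. \<forall>i\<le>psize \<pi>. insert_run i l \<pi> \<in> \<F>) \<and>
     (\<forall>\<pi>\<in>\<F>. \<forall>b\<in>\<pi>. is_run b \<longrightarrow> delete_run b \<pi> \<in> \<F>)"

text \<open>There are only finitely many standard s-partitions of each size, so the coefficients of
  the generating functions below are genuine finite sums.\<close>

lemma finite_standard_psize: "finite {\<pi>. standard \<pi> \<and> psize \<pi> = n}"
proof (rule finite_subset)
  let ?L = "{b :: nat list. set b \<subseteq> {1..n} \<and> length b \<le> n}"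
  show "{\<pi>. standard \<pi> \<and> psize \<pi> = n} \<subseteq> Pow ?L"
  proof (clarsimp simp: standard_def)
    fix \<pi> m b
    assume *: "s_partition {Suc 0..m} \<pi>" "b \<in> \<pi>" "n = psize \<pi>"
    have "ground \<pi> = {1..m}" using *(1) by (auto simp: s_partition_def ground_def)
    hence "psize \<pi> = m" by (simp add: psize_def)
    moreover have "set b \<subseteq> {1..m}" using * by (auto simp: s_partition_def)
    moreover from this have "card (set b) \<le> m" using card_mono[of "{1..m}" "set b"] by simp
    hence "length b \<le> m" using * by (simp add: s_partition_def distinct_card)
    ultimately show "set b \<subseteq> {Suc 0..psize \<pi>} \<and> length b \<le> psize \<pi>" by simp
  qed
  show "finite (Pow ?L)" using finite_lists_length_le[of "{1..n}" n] by simp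
qed


section \<open>Generating functions and the run transform\<close>

text \<open>Series in \<open>x\<close> and \<open>y\<close> are elements of \<^typ>\<open>'a fps fps\<close>: the outer variable is \<open>x\<close>, and
  the coefficients are power series in \<open>y\<close>.\<close>

definition varx :: "'a::field_char_0 fps fps" where
  "varx = fps_X"

definition vary :: "'a::field_char_0 fps fps" where
  "vary = fps_const fps_X"

definition lift_x :: "'a::field_char_0 fps \<Rightarrow> 'a fps fps" where
  "lift_x f = Abs_fps (\<lambda>n. fps_const (fps_nth f n))"

definition run_transform :: "'a::field_char_0 fps \<Rightarrow> 'a fps fps" where
  "run_transform f =
     (1 - varx) / (1 - varx * vary) *
     fps_compose (lift_x f) (varx * (1 - varx) / (1 - varx * vary))"

text \<open>The coefficient ring \<^typ>\<open>'a fps\<close> is not a field, but \<open>1 - xy\<close> has constant term \<open>1\<close>, so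
  the division is exact.\<close>

lemma run_transform_division:
  fixes g :: "'a::field_char_0 fps fps"
  shows "g / (1 - varx * vary) * (1 - varx * vary) = g"
proof -
  let ?d = "1 - varx * vary :: 'a fps fps"
  have d0: "fps_nth ?d 0 = 1" by (simp add: varx_def vary_def)
  have "?d \<noteq> 0" using d0 by (metis fps_zero_nth zero_neq_one)
  moreover have "subdegree ?d = 0" using d0 by (metis subdegree_eq_0 zero_neq_one)
  ultimately have "g / ?d = g * inverse ?d" by (simp add: fps_divide_def)
  moreover have "inverse ?d * ?d = 1"
    using fps_left_inverse'[of 1 ?d 1] unfolding fps_inverse_def[of ?d] d0 by simp
  ultimately show ?thesis by (simp add: mult.assoc)
qed

definition size_gf :: "nat list set set \<Rightarrow> 'a::field_char_0 fps" where
  "size_gf \<F> = Abs_fps (\<lambda>n. \<Sum>\<pi> | \<pi> \<in> \<F> \<and> psize \<pi> = n. 1)"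

definition size_run_gf :: "nat list set set \<Rightarrow> 'a::field_char_0 fps fps" where
  "size_run_gf \<F> = Abs_fps (\<lambda>n. \<Sum>\<pi> | \<pi> \<in> \<F> \<and> psize \<pi> = n. fps_X ^ num_runs \<pi>)"

end

theory Submission
  imports Defs
begin

text \<open>
  For a member \<open>\<pi>\<close> of size \<open>d + p\<close>, count only the runs contained in \<open>{1..p}\<close>, and let
  \<open>g\<^sub>d(x)\<close> be the resulting generating function in the variable \<open>x\<close> marking \<open>p\<close>. Passing from
  \<open>p\<close> to \<open>p + 1\<close> adds at most one run, namely a run \<open>i+1,\<dots>,p+1\<close>, and the members containing that
  run correspond, by deleting it, to the members of size \<open>d + i\<close>. As a result
  \<open>(1 - x y) g\<^sub>d = (1 - x) (f\<^sub>d + x g\<^sub>d\<^sub>+\<^sub>1)\<close>, where \<open>f\<^sub>d\<close> is the number of members of size \<open>d\<close>.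
  With \<open>A = (1 - x) / (1 - x y)\<close> this reads \<open>g\<^sub>d = A (f\<^sub>d + x g\<^sub>d\<^sub>+\<^sub>1)\<close>, whose unique power series
  solution is \<open>g\<^sub>d = A (f\<^sub>d + f\<^sub>d\<^sub>+\<^sub>1 (x A) + f\<^sub>d\<^sub>+\<^sub>2 (x A)\<^sup>2 + \<dots>)\<close>; take \<open>d = 0\<close>.
\<close>

section \<open>Runs and standard s-partitions\<close>

definition runs_upto :: "nat \<Rightarrow> nat list set \<Rightarrow> nat list set" where
  "runs_upto p \<pi> = {b \<in> \<pi>. is_run b \<and> set b \<subseteq> {..p}}"

lemma set_run_block: "set (run_block i l) = {i<..i + l}"
  by (auto simp: run_block_def)

lemma is_run_run_block: "l \<ge> 1 \<Longrightarrow> is_run (run_block i l)"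
  unfolding is_run_def by blast

lemma run_block_subset_iff:
  assumes "l \<ge> 1"
  shows "set (run_block i l) \<subseteq> {..p} \<longleftrightarrow> i + l \<le> p"
proof
  have "i + l \<in> set (run_block i l)" using assms by (simp add: set_run_block)
  thus "set (run_block i l) \<subseteq> {..p} \<Longrightarrow> i + l \<le> p" by blast
qed (auto simp: set_run_block)

lemma ground_standard:
  assumes "standard \<pi>"
  shows "ground \<pi> = {1..psize \<pi>}"
proof -
  obtain n where "ground \<pi> = {1..n}"
    using assms by (auto simp: standard_def s_partition_def ground_def)
  thus ?thesis by (simp add: psize_def)
qed

lemma standard_ne_Nil: "standard \<pi> \<Longrightarrow> b \<in> \<pi> \<Longrightarrow> b \<noteq> []"
  by (auto simp: standard_def s_partition_def)

lemma standard_block_eqI: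
  assumes "standard \<pi>" "b \<in> \<pi>" "c \<in> \<pi>" "j \<in> set b" "j \<in> set c"
  shows "b = c"
  using assms by (auto simp: standard_def s_partition_def disjoint_family_on_def)

text \<open>Nonempty disjoint blocks are determined by their entry sets, which are subsets of a
  finite ground set.\<close>

lemma finite_standard: "standard \<pi> \<Longrightarrow> finite \<pi>"
proof -
  assume st: "standard \<pi>"
  have "inj_on set \<pi>"
  proof (rule inj_onI)
    fix b c assume *: "b \<in> \<pi>" "c \<in> \<pi>" "set b = set c"
    hence "hd b \<in> set b" "hd b \<in> set c" using standard_ne_Nil[OF st] by fastforce+
    with * show "b = c" using standard_block_eqI[OF st] by blast
  qed
  moreover have "finite (set ` \<pi>)"
    by (rule finite_UnionD) (use st in \<open>auto simp: standard_def s_partition_def\<close>)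
  ultimately show ?thesis using finite_imageD by blast
qed

section \<open>Inserting and deleting runs\<close>

lemma insert_run_remove:
  assumes "l \<ge> 1"
  shows "insert_run i l \<pi> - {run_block i l} = map (\<lambda>j. if j > i then j + l else j) ` \<pi>"
proof -
  have "run_block i l \<noteq> map (\<lambda>j. if j > i then j + l else j) b" for b
  proof
    assume eq: "run_block i l = map (\<lambda>j. if j > i then j + l else j) b"
    \<comment> \<open>The shift skips the values i+1,...,i+l, so no shifted block contains
      \<open>Suc i\<close>.\<close>
    have "Suc i \<in> set (run_block i l)" using assms by (simp add: set_run_block)
    thus False using assms unfolding eq by (auto split: if_splits)
  qed
  hence "run_block i l \<notin> map (\<lambda>j. if j > i then j + l else j) ` \<pi>" by (metis (no_types) imageE)
  thus ?thesis unfolding insert_run_def by (rule Diff_insert_absorb)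
qed

lemma psize_insert_run:
  assumes "standard \<pi>"
  shows "psize (insert_run i l \<pi>) = psize \<pi> + l"
proof -
  define f where "f = (\<lambda>j. if j > i then j + l else j)"
  have g: "ground (insert_run i l \<pi>) = {i<..i + l} \<union> f ` ground \<pi>"
    by (auto simp: ground_def insert_run_def set_run_block f_def)
  have "finite (ground \<pi>)" using assms by (simp add: ground_standard)
  moreover have "{i<..i + l} \<inter> f ` ground \<pi> = {}"
    by (auto simp: f_def split: if_splits)
  moreover have "card (f ` ground \<pi>) = card (ground \<pi>)"
    by (rule card_image) (auto simp: inj_on_def f_def)
  ultimately show ?thesis by (simp add: psize_def g card_Un_disjoint)
qed

text \<open>Ranks below the gap are unchanged and those above it drop by \<open>l\<close>. This
  explicit form of standardization can be cancelled against the shift in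
  \<open>insert_run\<close>.\<close>

lemma standardize_remove_interval:
  assumes "ground \<sigma> = {1..n} - {i<..i + l}" "i + l \<le> n"
  shows "standardize \<sigma> = map (\<lambda>j. if j > i then j - l else j) ` \<sigma>"
proof -
  have mem: "k \<in> ground \<sigma> \<longleftrightarrow> 1 \<le> k \<and> k \<le> n \<and> (k \<le> i \<or> i + l < k)" for k
    by (auto simp: assms(1))
  have *: "card {k \<in> ground \<sigma>. k \<le> j} = (if j > i then j - l else j)" if j: "j \<in> ground \<sigma>" for j
  proof (cases "j > i")
    case True
    hence "i + l < j" "j \<le> n" using j by (simp_all add: mem)
    hence "{k \<in> ground \<sigma>. k \<le> j} = {1..j} - {i<..i + l}" "{i<..i + l} \<subseteq> {1..j}"
      by (auto simp: mem)
    thus ?thesis using True by (simp add: card_Diff_subset)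
  next
    case False
    hence "{k \<in> ground \<sigma>. k \<le> j} = {1..j}" using j by (auto simp: mem)
    thus ?thesis using False by simp
  qed
  show ?thesis unfolding standardize_def
  proof (rule image_cong[OF refl], rule map_cong[OF refl])
    fix b j assume "b \<in> \<sigma>" "j \<in> set b"
    hence "j \<in> ground \<sigma>" unfolding ground_def by blast
    thus "card {k \<in> ground \<sigma>. k \<le> j} = (if j > i then j - l else j)" by (rule *)
  qed
qed

lemma delete_insert_run:
  assumes "standard \<pi>" "l \<ge> 1" "i \<le> psize \<pi>"
  shows "delete_run (run_block i l) (insert_run i l \<pi>) = \<pi>"
proof -
  let ?f = "\<lambda>j. if j > i then j + l else j"
  have "ground (map ?f ` \<pi>) = ?f ` ground \<pi>" by (auto simp: ground_def)
  also have "\<dots> = {1..psize \<pi> + l} - {i<..i + l}"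
  proof (intro equalityI subsetI)
    fix j assume "j \<in> {1..psize \<pi> + l} - {i<..i + l}"
    hence "j = ?f (if j > i then j - l else j)" "(if j > i then j - l else j) \<in> ground \<pi>"
      using assms by (auto simp: ground_standard)
    thus "j \<in> ?f ` ground \<pi>" by (rule image_eqI)
  qed (use assms in \<open>auto simp: ground_standard\<close>)
  finally have "standardize (map ?f ` \<pi>) = map (\<lambda>j. if j > i then j - l else j) ` map ?f ` \<pi>"
    by (rule standardize_remove_interval) (use assms in simp)
  also have "\<dots> = (\<lambda>b. b) ` \<pi>"
    unfolding image_image by (rule image_cong) (auto simp: map_idI)
  finally show ?thesis
    unfolding delete_run_def insert_run_remove[OF assms(2)] by simp
qed

lemma insert_delete_run:
  assumes "standard \<pi>" "l \<ge> 1" "run_block i l \<in> \<pi>"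
  shows "insert_run i l (delete_run (run_block i l) \<pi>) = \<pi>"
proof -
  let ?\<sigma> = "\<pi> - {run_block i l}"
  have sub: "{i<..i + l} \<subseteq> {1..psize \<pi>}"
    using assms ground_standard[of \<pi>] set_run_block[of i l] by (auto simp: ground_def)
  have "set b \<inter> {i<..i + l} = {}" if "b \<in> ?\<sigma>" for b
    using that standard_block_eqI[OF assms(1) _ assms(3)] set_run_block[of i l] by blast
  moreover have "ground \<pi> = ground ?\<sigma> \<union> {i<..i + l}"
    using assms(3) set_run_block[of i l] by (auto simp: ground_def)
  ultimately have g: "ground ?\<sigma> = {1..psize \<pi>} - {i<..i + l}"
    unfolding ground_standard[OF assms(1)] by (auto simp: ground_def)
  have "delete_run (run_block i l) \<pi> = map (\<lambda>j. if j > i then j - l else j) ` ?\<sigma>"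
    unfolding delete_run_def using g
    by (rule standardize_remove_interval) (use sub assms(2) in \<open>auto simp: subset_iff\<close>)
  moreover have "map (\<lambda>j. if j > i then j + l else j)
      ` map (\<lambda>j. if j > i then j - l else j) ` ?\<sigma> = (\<lambda>b. b) ` ?\<sigma>"
    unfolding image_image
  proof (rule image_cong)
    fix b assume "b \<in> ?\<sigma>"
    \<comment> \<open>Outside the gap the two shifts cancel: for j > i + l the subtraction is not
      truncated and j - l still exceeds i.\<close>
    hence "j \<le> i \<or> j > i + l" if "j \<in> set b" for j
    proof -
      have "j \<in> ground ?\<sigma>" using \<open>b \<in> ?\<sigma>\<close> that unfolding ground_def by blast
      thus ?thesis unfolding g by auto
    qed
    thus "map (\<lambda>j. if j > i then j + l else j) (map (\<lambda>j. if j > i then j - l else j) b) = b"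
      by (force intro: map_idI)
  qed simp
  ultimately show ?thesis using assms(3) by (auto simp: insert_run_def)
qed

section \<open>Runs inside an initial segment\<close>

text \<open>The shift fixes every value up to \<open>i\<close> and moves no larger value down to
  \<open>i\<close>, and the new run lies above \<open>i\<close>.\<close>

lemma runs_upto_insert_run:
  assumes "l \<ge> 1"
  shows "runs_upto i (insert_run i l \<pi>) = runs_upto i \<pi>"
proof -
  let ?f = "\<lambda>j. if j > i then j + l else j"
  have id: "map ?f b = b" if "set b \<subseteq> {..i}" for b
    using that by (force intro: map_idI)
  have sub: "set b \<subseteq> {..i}" if "set (map ?f b) \<subseteq> {..i}" for b
    using that by (force split: if_splits)
  have "b \<in> insert_run i l \<pi> \<longleftrightarrow> b \<in> \<pi>" if b: "set b \<subseteq> {..i}" for b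
  proof
    assume "b \<in> insert_run i l \<pi>"
    moreover have "b \<noteq> run_block i l" using b assms run_block_subset_iff[OF assms, of i i] by auto
    ultimately obtain c where c: "c \<in> \<pi>" "b = map ?f c" unfolding insert_run_def by blast
    have "b = c" using b unfolding c(2) by (rule id[OF sub])
    with c(1) show "b \<in> \<pi>" by simp
  next
    assume "b \<in> \<pi>"
    hence "map ?f b \<in> insert_run i l \<pi>" unfolding insert_run_def by (intro insertI2 imageI)
    thus "b \<in> insert_run i l \<pi>" unfolding id[OF b] .
  qed
  thus ?thesis unfolding runs_upto_def by (intro Collect_cong) blast
qed

text \<open>At most one block is a run ending at p+1. If it is i+1,...,p+1, it fills all these
  values, so the runs up to p are those up to i; with k of them, the new run contributes y^(k+1) =
  y^k + (y-1) y^k. Counting only up to i gives a weight that survives deletion of that run.\<close>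

lemma power_runs_upto_Suc:
  fixes y :: "'b::comm_ring_1"
  assumes "standard \<pi>"
  shows "y ^ card (runs_upto (Suc p) \<pi>) = y ^ card (runs_upto p \<pi>) +
    (\<Sum>i\<le>p. if run_block i (Suc p - i) \<in> \<pi> then (y - 1) * y ^ card (runs_upto i \<pi>) else 0)"
proof (cases "\<exists>i\<le>p. run_block i (Suc p - i) \<in> \<pi>")
  case True
  then obtain i where i: "i \<le> p" "run_block i (Suc p - i) \<in> \<pi>" by blast
  let ?b = "run_block i (Suc p - i)"
  have sb: "set ?b = {i<..Suc p}" using i by (simp add: set_run_block)
  have *: "c = ?b" if "c \<in> \<pi>" "j \<in> set c" "i < j" "j \<le> Suc p" for c j
    using standard_block_eqI[OF assms that(1) i(2) that(2)] that sb by auto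
  have b: "?b \<in> runs_upto (Suc p) \<pi>"
    using i by (simp add: runs_upto_def is_run_run_block run_block_subset_iff)
  have mono: "runs_upto i \<pi> \<subseteq> runs_upto p \<pi>" "runs_upto p \<pi> \<subseteq> runs_upto (Suc p) \<pi>"
    using i(1) by (fastforce simp: runs_upto_def)+
  have "c \<in> insert ?b (runs_upto i \<pi>)" if "c \<in> runs_upto (Suc p) \<pi>" for c
  proof (cases "set c \<subseteq> {..i}")
    case False
    then obtain j where "j \<in> set c" "i < j" by (auto simp: subset_iff)
    thus ?thesis using that *[of c j] by (auto simp: runs_upto_def)
  qed (use that in \<open>simp add: runs_upto_def\<close>)
  hence S: "runs_upto (Suc p) \<pi> = insert ?b (runs_upto i \<pi>)" using b mono by blast
  have "?b \<notin> runs_upto p \<pi>" using i by (simp add: runs_upto_def run_block_subset_iff)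
  moreover have "runs_upto p \<pi> \<subseteq> insert ?b (runs_upto i \<pi>)" using mono(2) unfolding S .
  ultimately have P: "runs_upto p \<pi> = runs_upto i \<pi>"
    using mono(1) by (simp add: subset_insert subset_antisym)
  have "?b \<notin> runs_upto i \<pi>" using i by (simp add: runs_upto_def run_block_subset_iff)
  moreover have "finite (runs_upto i \<pi>)" using finite_standard[OF assms] by (simp add: runs_upto_def)
  moreover have "run_block k (Suc p - k) \<in> \<pi> \<longleftrightarrow> k = i" if "k \<le> p" for k
  proof
    \<comment> \<open>Both runs contain p+1, hence are the same block; its cardinality recovers the
      starting point.\<close>
    assume k: "run_block k (Suc p - k) \<in> \<pi>"
    have "set (run_block k (Suc p - k)) = {k<..Suc p}" using that by (simp add: set_run_block)
    hence "{k<..Suc p} = {i<..Suc p}" using *[OF k, of "Suc p"] sb that i by auto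
    thus "k = i" using that i by (metis card_greaterThanAtMost diff_diff_cancel le_SucI)
  qed (use i in simp)
  hence "(\<Sum>k\<le>p. if run_block k (Suc p - k) \<in> \<pi> then (y - 1) * y ^ card (runs_upto k \<pi>) else 0)
    = (\<Sum>k\<le>p. if k = i then (y - 1) * y ^ card (runs_upto k \<pi>) else 0)"
    by (intro sum.cong) auto
  ultimately show ?thesis using i by (simp add: S P algebra_simps)
next
  case False
  \<comment> \<open>A run within \<open>{..Suc p}\<close> but not within \<open>{..p}\<close> would
    end at p+1, the excluded case.\<close>
  have "set b \<subseteq> {..p}" if b: "b \<in> \<pi>" "is_run b" "set b \<subseteq> {..Suc p}" for b
  proof (rule ccontr)
    assume n: "\<not> set b \<subseteq> {..p}"
    obtain i l where il: "l \<ge> 1" "b = run_block i l" using b(2) by (auto simp: is_run_def)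
    hence "i + l = Suc p" using b(3) n by (simp add: run_block_subset_iff)
    hence "i \<le> p" "l = Suc p - i" using il by auto
    thus False using False il b(1) by blast
  qed
  moreover have "{..p} \<subseteq> {..Suc p}" by simp
  ultimately have "runs_upto (Suc p) \<pi> = runs_upto p \<pi>"
    unfolding runs_upto_def by (intro Collect_cong) (meson subset_trans)
  thus ?thesis using False by simp
qed

section \<open>The series for runs in initial segments\<close>

text \<open>This is the family \<open>g d\<close>; \<open>y\<close> stays an arbitrary ring element,
  later specialized to the variable of the coefficient ring.\<close>

definition partial_gf :: "nat list set set \<Rightarrow> 'b::comm_ring_1 \<Rightarrow> nat \<Rightarrow> 'b fps" where
  "partial_gf \<F> y d =
     Abs_fps (\<lambda>p. \<Sum>\<pi> | \<pi> \<in> \<F> \<and> psize \<pi> = d + p. y ^ card (runs_upto p \<pi>))"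

context
  fixes \<F> :: "nat list set set"
  assumes closed: "run_closed \<F>"
begin

lemma family_standard: "\<pi> \<in> \<F> \<Longrightarrow> standard \<pi>"
  using closed by (simp add: run_closed_def)

lemma finite_family_psize: "finite {\<pi> \<in> \<F>. psize \<pi> = n}"
  by (rule finite_subset[OF _ finite_standard_psize[of n]]) (use family_standard in auto)

text \<open>Deletion and insertion of the run are mutually inverse, stay in the family by closure,
  and keep the weight because only runs up to \<open>i\<close> are counted.\<close>

lemma sum_family_with_run:
  fixes y :: "'b::comm_ring_1"
  assumes "l \<ge> 1" "i \<le> n"
  shows "(\<Sum>\<pi> | \<pi> \<in> \<F> \<and> psize \<pi> = n + l \<and> run_block i l \<in> \<pi>. y ^ card (runs_upto i \<pi>)) =
    (\<Sum>\<pi> | \<pi> \<in> \<F> \<and> psize \<pi> = n. y ^ card (runs_upto i \<pi>))"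
proof (rule sum.reindex_bij_witness[where i = "insert_run i l" and j = "delete_run (run_block i l)"],
    goal_cases)
  case (1 \<pi>)
  thus ?case using assms by (simp add: insert_delete_run family_standard)
next
  case (2 \<pi>)
  let ?\<sigma> = "delete_run (run_block i l) \<pi>"
  have "is_run (run_block i l)" using assms by (simp add: is_run_run_block)
  hence "?\<sigma> \<in> \<F>" using 2 closed by (auto simp: run_closed_def)
  moreover have "insert_run i l ?\<sigma> = \<pi>"
    using 2 assms by (simp add: insert_delete_run family_standard)
  ultimately show ?case using psize_insert_run[of ?\<sigma> i l] 2 by (simp add: family_standard)
next
  case (3 \<pi>)
  thus ?case using assms by (simp add: delete_insert_run family_standard)
next
  case (4 \<pi>)
  hence "insert_run i l \<pi> \<in> \<F>" using closed assms by (auto simp: run_closed_def)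
  thus ?case using 4 by (simp add: psize_insert_run family_standard) (simp add: insert_run_def)
next
  case (5 \<pi>)
  hence "insert_run i l (delete_run (run_block i l) \<pi>) = \<pi>"
    using assms by (simp add: insert_delete_run family_standard)
  thus ?case using runs_upto_insert_run[OF assms(1)] by metis
qed

text \<open>\<open>power_runs_upto_Suc\<close> is summed over the members of size d+p+1 = (d+1)+p,
  whence the shift to \<open>Suc d\<close> in the first term. Deleting i+1,...,p+1 leaves size d+i,
  so the other terms keep the same d.\<close>

lemma partial_gf_Suc:
  "fps_nth (partial_gf \<F> y d) (Suc p) = fps_nth (partial_gf \<F> y (Suc d)) p +
     (y - 1) * (\<Sum>i\<le>p. fps_nth (partial_gf \<F> y d) i)"
proof -
  let ?A = "{\<pi> \<in> \<F>. psize \<pi> = Suc (d + p)}"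
  let ?r = "\<lambda>i \<pi>. y ^ card (runs_upto i \<pi>)"
  have "(\<Sum>\<pi>\<in>?A. ?r (Suc p) \<pi>) = (\<Sum>\<pi>\<in>?A. ?r p \<pi> +
      (\<Sum>i\<le>p. if run_block i (Suc p - i) \<in> \<pi> then (y - 1) * ?r i \<pi> else 0))"
    by (intro sum.cong refl power_runs_upto_Suc) (auto intro: family_standard)
  also have "\<dots> = (\<Sum>\<pi>\<in>?A. ?r p \<pi>) + (\<Sum>i\<le>p. \<Sum>\<pi>\<in>?A.
      if run_block i (Suc p - i) \<in> \<pi> then (y - 1) * ?r i \<pi> else 0)"
    by (simp only: sum.distrib) (subst sum.swap, rule refl)
  also have "(\<Sum>i\<le>p. \<Sum>\<pi>\<in>?A. if run_block i (Suc p - i) \<in> \<pi> then (y - 1) * ?r i \<pi> else 0) =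
      (\<Sum>i\<le>p. (y - 1) * fps_nth (partial_gf \<F> y d) i)"
  proof (intro sum.cong refl)
    fix i assume "i \<in> {..p}"
    hence i: "i \<le> p" "Suc (d + p) = (d + i) + (Suc p - i)" by auto
    have "(\<Sum>\<pi>\<in>?A. if run_block i (Suc p - i) \<in> \<pi> then (y - 1) * ?r i \<pi> else 0) =
        (y - 1) * (\<Sum>\<pi> | \<pi> \<in> \<F> \<and> psize \<pi> = (d + i) + (Suc p - i) \<and>
          run_block i (Suc p - i) \<in> \<pi>. ?r i \<pi>)"
      unfolding i(2)[symmetric] sum_distrib_left
      using finite_family_psize by (subst sum.inter_filter[symmetric]) (auto intro: sum.cong)
    also have "\<dots> = (y - 1) * fps_nth (partial_gf \<F> y d) i"
      using i(1) by (subst sum_family_with_run) (auto simp: partial_gf_def)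
    finally show "(\<Sum>\<pi>\<in>?A. if run_block i (Suc p - i) \<in> \<pi> then (y - 1) * ?r i \<pi> else 0) =
        (y - 1) * fps_nth (partial_gf \<F> y d) i" .
  qed
  finally show ?thesis by (simp add: partial_gf_def sum_distrib_left)
qed

lemma partial_gf_0: "fps_nth (partial_gf \<F> y d) 0 = of_nat (card {\<pi> \<in> \<F>. psize \<pi> = d})"
proof -
  have "runs_upto 0 \<pi> = {}" for \<pi>
    using run_block_subset_iff[where p = 0] unfolding runs_upto_def is_run_def by fastforce
  thus ?thesis by (simp add: partial_gf_def)
qed

text \<open>Partial sums of coefficients amount to division by 1 - x. Clearing it and collecting the
  terms in \<open>partial_gf \<F> y d\<close> gives the factor 1 - x - x (y - 1) = 1 - x y.\<close>

lemma partial_gf_equation: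
  fixes y :: "'b::comm_ring_1"
  shows "(1 - fps_X * fps_const y) * partial_gf \<F> y d =
    (1 - fps_X) * (fps_const (of_nat (card {\<pi> \<in> \<F>. psize \<pi> = d})) + fps_X * partial_gf \<F> y (Suc d))"
proof -
  define S where "S = Abs_fps (\<lambda>p. \<Sum>i\<le>p. fps_nth (partial_gf \<F> y d) i)"
  have S: "(1 - fps_X) * S = partial_gf \<F> y d"
  proof (rule fps_ext)
    fix n show "fps_nth ((1 - fps_X) * S) n = fps_nth (partial_gf \<F> y d) n"
      by (cases n) (simp_all add: S_def algebra_simps)
  qed
  have "partial_gf \<F> y d = fps_const (of_nat (card {\<pi> \<in> \<F>. psize \<pi> = d})) +
      fps_X * partial_gf \<F> y (Suc d) + fps_X * (fps_const (y - 1) * S)" (is "_ = ?c + _")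
  proof (rule fps_ext)
    fix n
    show "fps_nth (partial_gf \<F> y d) n = fps_nth (?c + fps_X * (fps_const (y - 1) * S)) n"
      by (cases n) (simp_all add: partial_gf_0 partial_gf_Suc S_def del: fps_const_sub)
  qed
  also have "fps_const (y - 1) = fps_const y - 1" by (simp flip: fps_const_sub)
  finally have "(1 - fps_X) * partial_gf \<F> y d =
      (1 - fps_X) * ?c + fps_X * (fps_const y - 1) * ((1 - fps_X) * S)"
    by (metis (no_types, lifting) distrib_left mult.assoc mult.left_commute)
  thus ?thesis unfolding S by (simp add: algebra_simps)
qed

end

section \<open>Solving the recurrence in d\<close>

text \<open>The factor \<open>fps_X\<close> makes each coefficient of \<open>e d\<close> depend only
  on earlier ones of \<open>e (Suc d)\<close>, so induction on the index works for all d at once.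
  Applied to a difference of solutions, this gives uniqueness.\<close>

lemma fps_shift_eq_0:
  fixes e :: "nat \<Rightarrow> 'b::comm_ring_1 fps"
  assumes "\<And>d. e d = fps_X * (A * e (Suc d))"
  shows "e d = 0"
proof -
  have "fps_nth (e d) n = 0" for n
  proof (induction n arbitrary: d rule: less_induct)
    case (less n)
    have "fps_nth (A * e (Suc d)) (n - 1) = 0" if "n > 0"
      unfolding fps_mult_nth using that by (intro sum.neutral) (auto simp: less)
    thus ?case by (subst assms) simp
  qed
  thus ?thesis by (simp add: fps_ext)
qed

text \<open>Composition with \<open>a\<close> is multiplicative because its constant term is zero,
  so splitting off \<open>f 0\<close> leaves a factor \<open>a\<close>.\<close>

lemma fps_compose_shift:
  fixes f :: "nat \<Rightarrow> 'b::idom"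
  assumes "fps_nth a 0 = 0"
  shows "fps_compose (Abs_fps f) a = fps_const (f 0) + a * fps_compose (Abs_fps (\<lambda>n. f (Suc n))) a"
proof -
  have "Abs_fps f = fps_const (f 0) + Abs_fps (\<lambda>n. f (Suc n)) * fps_X"
  proof (rule fps_ext)
    fix n show "fps_nth (Abs_fps f) n = fps_nth (fps_const (f 0) + Abs_fps (\<lambda>n. f (Suc n)) * fps_X) n"
      by (cases n) simp_all
  qed
  hence "fps_compose (Abs_fps f) a =
      fps_compose (fps_const (f 0) + Abs_fps (\<lambda>n. f (Suc n)) * fps_X) a" by simp
  thus ?thesis
    using assms by (simp add: fps_compose_add_distrib fps_compose_mult_distrib mult.commute)
qed

theorem theorem8:
  fixes \<F> :: "nat list set set"
  assumes "run_closed \<F>"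
  shows "run_transform (size_gf \<F> :: 'a::field_char_0 fps) = size_run_gf \<F>"
proof -
  let ?D = "1 - varx * vary :: 'a fps fps"
  define A where "A = (1 - varx) / ?D"
  define a where "a = varx * (1 - varx) / ?D"
  define c :: "nat \<Rightarrow> 'a fps" where "c d = of_nat (card {\<pi> \<in> \<F>. psize \<pi> = d})" for d
  \<comment> \<open>\<open>h d\<close> drops the first d coefficients of the size series before
    composing; \<open>A * h d\<close> is the claimed value of \<open>g d\<close>.\<close>
  define h where "h d = fps_compose (Abs_fps (\<lambda>n. c (n + d))) a" for d
  define g where "g d = partial_gf \<F> (fps_X :: 'a fps) d" for d
  have D0: "?D \<noteq> 0"
  proof
    assume "?D = 0"
    hence "fps_nth ?D 0 = 0" by simp
    thus False by (simp add: varx_def vary_def)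
  qed
  have AD: "A * ?D = 1 - varx" unfolding A_def by (rule run_transform_division)
  \<comment> \<open>The argument of the composition is x times the prefactor \<open>A\<close>; this
    is compared after clearing the denominator.\<close>
  have "a * ?D = varx * (A * ?D)"
    unfolding AD a_def by (rule run_transform_division)
  hence a: "a = fps_X * A" using D0 by (simp add: varx_def)
  have "g d = A * (fps_const (c d) + fps_X * g (Suc d))" for d
  proof -
    have "?D * g d = ?D * (A * (fps_const (c d) + fps_X * g (Suc d)))"
      using partial_gf_equation[OF assms, of "fps_X :: 'a fps" d] AD
      by (simp add: g_def c_def varx_def vary_def mult.assoc[symmetric] mult.commute[of _ A])
    thus ?thesis using D0 by simp
  qed
  moreover have "h d = fps_const (c d) + fps_X * A * h (Suc d)" for d
    using fps_compose_shift[of a "\<lambda>n. c (n + d)"] by (simp add: h_def a)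
  \<comment> \<open>\<open>g\<close> and \<open>A * h\<close> solve the same recurrence, so the
    inhomogeneous terms \<open>c d\<close> cancel in the difference.\<close>
  ultimately have "g d - A * h d = fps_X * (A * (g (Suc d) - A * h (Suc d)))" for d
    by (metis (no_types, lifting) add_diff_cancel_left mult.assoc mult.left_commute right_diff_distrib)
  hence "g 0 - A * h 0 = 0" by (rule fps_shift_eq_0)
  moreover have "h 0 = fps_compose (lift_x (size_gf \<F>)) a"
    by (simp add: h_def lift_x_def size_gf_def c_def fps_of_nat)
  moreover have "g 0 = size_run_gf \<F>"
  proof -
    \<comment> \<open>For d = 0 the cutoff is the full size, and every block lies below it, so no
      run is lost.\<close>
    have "runs_upto (psize \<pi>) \<pi> = {b \<in> \<pi>. is_run b}" if "\<pi> \<in> \<F>" for \<pi>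
      using ground_standard[OF family_standard[OF assms that]]
      by (auto simp: runs_upto_def ground_def)
    thus ?thesis
      unfolding g_def partial_gf_def size_run_gf_def num_runs_def
      by (intro arg_cong[of _ _ Abs_fps] ext sum.cong) auto
  qed
  ultimately show ?thesis by (simp add: run_transform_def A_def a_def)
qed

end
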